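(* Let $(X,d)$ be a complete metric space and let $Y$ be a locally convex space. Let $K\subset Y$ be a closed and convex cone in $Y$ and let $D\subset K$ be a nonempty, closed, semi-complete, convex and bounded subset of $K$ such that $0\notin \overline{D+K}$. Let $f:X\to Y$ be monotonically semicontinuous with respect to $K$ on $X$ and $K$-bounded. Then for every $x\in X$ there exists $\bar{x}\in X$ such that (i) $\big(f(x)-K\big)\cap\big(f(\bar{x})+d(x,\bar{x})D\big)\neq\emptyset$, (ii) $\big(f(\bar{x})-K\big)\cap\big(f(z)+d(z,\bar{x})D\big)=\emptyset$ for every $z\in X$ with $z\neq\bar{x}$.
   Context: A locally convex space is a (real) linear topological space with a local base consisting of convex neighborhoods of the origin. $\overline{A}$ denotes the topological closure of $A$. For sets $A,B\subset Y$, $y\in Y$ and $t\in\mathbb{R}$: $A+B=\{a+b: a\in A, b\in B\}$, $y-A=\{y-a: a\in A\}$, $y+tA=\{y+ta: a\in A\}$. For $u,v\in Y$ write $u\le_K v$ if and only if $v-u\in K$. A subset $D\subset Y$ is semi-complete if every Cauchy sequence contained in $D$ has a limit in $D$. A function $f:X\to Y$ is monotonically semicontinuous with respect to $K$ at $x\in X$ if for every sequence $(x_i)\subset X$ with $x_i\to x$ satisfying $f(x_{i+1})\le_K f(x_i)$ for all $i\in\mathbb{N}$, we have $f(x)\le_K f(x_i)$ for all $i\in\mathbb{N}$. It is monotonically semicontinuous on $X$ if this holds at every $x\in X$. A function $f:X\to Y$ is $K$-bounded if there exists a bounded subset $M$ of $Y$ such that $f(X)\subset K+M$. Bounded subsets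 of $Y$ are meant in the sense of topological vector spaces (absorbed by every neighborhood of $0$). *)

theory Defs
  imports "HOL-Analysis.Analysis" "HOL-Library.Set_Algebras"
begin

class linear_topological_space = real_vector + topological_ab_group_add +
  assumes tendsto_scaleR_Pair:
      "LIM x (nhds (c :: real) \<times>\<^sub>F nhds a). fst x *\<^sub>R snd x :> nhds (c *\<^sub>R a)"

text \<open>
  No separation axiom is required, and neighbourhoods in the local base need not be open.  The class
  assumption spells out \<^const>\<open>convex\<close> and \<^const>\<open>interior\<close>, which carry sort constraints that a class
  specification does not accept; \<open>convex_local_base\<close> below restates it.
\<close>

class locally_convex_space = linear_topological_space +
  assumes ex_convex_neighbourhood:
    "open U \<Longrightarrow> 0 \<in> U \<Longrightarrow>
      \<exists>V W. (\<forall>x\<in>V. \<forall>y\<in>V. \<forall>u\<ge>0. \<forall>v\<ge>0. u + v = 1 \<longrightarrow> u *\<^sub>R x + v *\<^sub>R y \<in> V) \<and>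
            open W \<and> 0 \<in> W \<and> W \<subseteq> V \<and> V \<subseteq> U"

lemma convex_local_base:
  fixes U :: "'b::locally_convex_space set"
  assumes "open U" "0 \<in> U"
  shows "\<exists>V. convex V \<and> 0 \<in> interior V \<and> V \<subseteq> U"
  using ex_convex_neighbourhood[OF assms] unfolding convex_def interior_def by blast

instance real_normed_vector \<subseteq> locally_convex_space
proof
  fix c :: real and a :: 'a
  show "LIM x (nhds c \<times>\<^sub>F nhds a). fst x *\<^sub>R snd x :> nhds (c *\<^sub>R a)"
    by (intro tendsto_scaleR filterlim_fst filterlim_snd)
next
  fix U :: "'a set"
  assume "open U" "0 \<in> U"
  then obtain e where "e > 0" "ball 0 e \<subseteq> U"
    by (meson open_contains_ball)
  moreover have "\<forall>x\<in>ball 0 e. \<forall>y\<in>ball 0 e. \<forall>u\<ge>0. \<forall>v\<ge>0. u + v = 1 \<longrightarrow>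
      u *\<^sub>R x + v *\<^sub>R y \<in> ball (0 :: 'a) e"
    using convex_ball[of "0 :: 'a" e] unfolding convex_def .
  ultimately show "\<exists>V W. (\<forall>x\<in>V. \<forall>y\<in>V. \<forall>u\<ge>0. \<forall>v\<ge>0. u + v = 1 \<longrightarrow> u *\<^sub>R x + v *\<^sub>R y \<in> V) \<and>
      open W \<and> 0 \<in> W \<and> W \<subseteq> V \<and> V \<subseteq> U"
    by (intro exI[of _ "ball 0 e"] conjI) auto
qed

text \<open>
  The library's \<^const>\<open>bounded\<close> is metric and its \<^const>\<open>Cauchy\<close> needs a uniform space, so the
  notions for topological vector spaces are defined here.
\<close>

definition tvs_bounded :: "'b::locally_convex_space set \<Rightarrow> bool" where
  "tvs_bounded M \<longleftrightarrow>
     (\<forall>U. open U \<and> 0 \<in> U \<longrightarrow> (\<exists>r>0. \<forall>t::real. \<bar>t\<bar> \<ge> r \<longrightarrow> M \<subseteq> (\<lambda>u. t *\<^sub>R u) ` U))"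

definition tvs_Cauchy :: "(nat \<Rightarrow> 'b::locally_convex_space) \<Rightarrow> bool" where
  "tvs_Cauchy s \<longleftrightarrow> (\<forall>U. open U \<and> 0 \<in> U \<longrightarrow> (\<exists>N. \<forall>m\<ge>N. \<forall>n\<ge>N. s m - s n \<in> U))"

definition semi_complete :: "'b::locally_convex_space set \<Rightarrow> bool" where
  "semi_complete D \<longleftrightarrow>
     (\<forall>s. (\<forall>n. s n \<in> D) \<and> tvs_Cauchy s \<longrightarrow> (\<exists>l\<in>D. s \<longlonglongrightarrow> l))"

definition cone_le :: "'b::locally_convex_space set \<Rightarrow> 'b \<Rightarrow> 'b \<Rightarrow> bool" where
  "cone_le K u v \<longleftrightarrow> v - u \<in> K"

definition monotonically_semicontinuous_at ::
    "'b::locally_convex_space set \<Rightarrow> ('a::topological_space \<Rightarrow> 'b) \<Rightarrow> 'a \<Rightarrow> bool" where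
  "monotonically_semicontinuous_at K f x \<longleftrightarrow>
     (\<forall>s. s \<longlonglongrightarrow> x \<and> (\<forall>i. cone_le K (f (s (Suc i))) (f (s i)))
        \<longrightarrow> (\<forall>i. cone_le K (f x) (f (s i))))"

definition monotonically_semicontinuous ::
    "'b::locally_convex_space set \<Rightarrow> ('a::topological_space \<Rightarrow> 'b) \<Rightarrow> bool" where
  "monotonically_semicontinuous K f \<longleftrightarrow> (\<forall>x. monotonically_semicontinuous_at K f x)"

definition cone_bounded :: "'b::locally_convex_space set \<Rightarrow> ('a \<Rightarrow> 'b) \<Rightarrow> bool" where
  "cone_bounded K f \<longleftrightarrow> (\<exists>M. tvs_bounded M \<and> range f \<subseteq> K + M)"

end

theory Submission
  imports Defs
begin

text \<open>
  Write \<open>z \<preceq> x\<close> if \<open>f x - f z - d(x,z) v \<in> K\<close> for some \<open>v \<in> D\<close>.  The first conclusion says \<open>xb \<preceq> x\<close> and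
  the second that nothing else lies below \<open>xb\<close>, so the theorem asks for a minimal element
  below \<open>x\<close>.  The relation is transitive: convexity of \<open>D\<close> merges two steps along \<open>v\<close> and \<open>w\<close> into one
  along some \<open>u \<in> D\<close> of length \<open>d(x,y) + d(y,z)\<close>, and \<open>D \<subseteq> K\<close> allows this length to be cut down to
  \<open>d(x,z)\<close>.  For such a preorder, a minimal element below \<open>x\<close> exists as soon as every descending
  sequence converges to a point below all its terms: going down by steps that are as long as
  possible up to a factor leaves room for only one point under the limit
  (\<open>ex_minimal_of_chain_limits\<close>).

  Why descending sequences converge: by merging, a chain of total length \<open>t\<close> starting at \<open>x\<close> gives
  \<open>f x - f z - t v \<in> K\<close> with \<open>v \<in> D\<close>.  If \<open>f z = k + m\<close> with \<open>k \<in> K\<close> and \<open>m\<close> in the bounded set \<open>M\<close>, dividing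
  by \<open>t\<close> puts \<open>(f x - m) / t\<close> into \<open>D + K\<close>.  For large \<open>t\<close> this point lies in a neighbourhood of \<open>0\<close>
  disjoint from \<open>D + K\<close>; so \<open>t\<close> is bounded (\<open>descent_length_bounded\<close>), and a chain has finite length and
  is Cauchy.

  Why the limit \<open>l\<close> lies below: semicontinuity only yields \<open>f l \<le>\<^sub>K f (s n)\<close>, and the element of \<open>D\<close> has
  to be found.  Up to its \<open>m\<close>-th term, the chain has merged direction \<open>w\<^sub>m \<in> D\<close>, the average of the
  directions of its steps weighted by their lengths.  Since the lengths are summable and \<open>D\<close> is
  bounded, the \<open>w\<^sub>m\<close> form a Cauchy sequence, which converges in \<open>D\<close> (\<open>weighted_series_converges\<close>);
  closedness of \<open>K\<close> then carries the relation to the limit (\<open>descent_chain_limit\<close>).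
\<close>

section \<open>Minimal elements of a preorder on a metric space\<close>

text \<open>
  Let \<open>s (n + 1)\<close> be a point below \<open>s n\<close> whose distance from \<open>s n\<close> is at least half the supremum over
  all points below \<open>s n\<close>.  A point \<open>z\<close> below the limit is below every \<open>s n\<close>, hence its
  truncated distance from \<open>s n\<close> is at most twice the next step; the steps tend to \<open>0\<close>, so \<open>z\<close> is the limit.  The distances are truncated at \<open>1\<close>, which
  keeps the supremum finite when the set of points below is unbounded.
\<close>

lemma ex_minimal_of_chain_limits:
  fixes R :: "'a::metric_space \<Rightarrow> 'a \<Rightarrow> bool"
  assumes refl: "\<And>x. R x x"
    and trans: "\<And>x y z. R x y \<Longrightarrow> R y z \<Longrightarrow> R x z"
    and chain: "\<And>s. (\<And>n. R (s n) (s (Suc n))) \<Longrightarrow> \<exists>l. s \<longlonglongrightarrow> l \<and> (\<forall>n. R (s n) l)"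
  shows "\<exists>xb. R x xb \<and> (\<forall>z. R xb z \<longrightarrow> z = xb)"
proof -
  have far: "\<exists>y. R x y \<and> (\<forall>z. R x z \<longrightarrow> min 1 (dist x z) \<le> 2 * dist x y)" for x
  proof -
    define S where "S = (\<lambda>z. min 1 (dist x z)) ` {z. R x z}"
    have bdd: "bdd_above S"
      unfolding S_def by (rule bdd_aboveI[of _ 1]) auto
    have upper: "min 1 (dist x z) \<le> Sup S" if "R x z" for z
      using that bdd by (auto simp: S_def intro!: cSup_upper)
    show ?thesis
    proof (cases "Sup S \<le> 0")
      case True
      then have "min 1 (dist x z) \<le> 2 * dist x x" if "R x z" for z
        using order_trans[OF upper[OF that] True] by (simp only: dist_self mult_zero_right)
      then show ?thesis
        using refl by blast
    next
      case False
      have "S \<noteq> {}"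
        using refl by (auto simp: S_def)
      then obtain c where "c \<in> S" "Sup S / 2 < c"
        using less_cSup_iff[OF _ bdd, of "Sup S / 2"] False by auto
      then obtain y where "R x y" "Sup S / 2 < min 1 (dist x y)"
        unfolding S_def by blast
      then show ?thesis
        using upper by (intro exI[of _ y]) fastforce
    qed
  qed
  then obtain g where g: "\<And>x. R x (g x)"
    "\<And>x z. R x z \<Longrightarrow> min 1 (dist x z) \<le> 2 * dist x (g x)"
    by metis
  define s where "s n = (g ^^ n) x" for n
  have step: "s (Suc n) = g (s n)" for n
    by (simp add: s_def)
  obtain l where l: "s \<longlonglongrightarrow> l" "\<And>n. R (s n) l"
    using chain[of s] g(1) step by metis
  have "z = l" if "R l z" for z
  proof -
    have "(\<lambda>n. min 1 (dist (s n) z)) \<longlonglongrightarrow> min 1 (dist l z)"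
      by (intro tendsto_intros l)
    moreover have "(\<lambda>n. 2 * dist (s n) (s (Suc n))) \<longlonglongrightarrow> 2 * dist l l"
      using LIMSEQ_Suc[OF l(1)] by (intro tendsto_intros l)
    moreover have "\<exists>N. \<forall>n\<ge>N. min 1 (dist (s n) z) \<le> 2 * dist (s n) (s (Suc n))"
      using g(2) trans[OF l(2) that] step by metis
    ultimately have "min 1 (dist l z) \<le> 2 * dist l l"
      by (rule LIMSEQ_le)
    then show ?thesis
      by (simp add: min_def split: if_splits)
  qed
  moreover have "R x l"
    using l(2)[of 0] by (simp add: s_def)
  ultimately show ?thesis
    by blast
qed

lemma dist_le_sum_steps:
  fixes s :: "nat \<Rightarrow> 'a::metric_space"
  assumes "n \<le> m"
  shows "dist (s n) (s m) \<le> (\<Sum>i=n..<m. dist (s i) (s (Suc i)))"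
  using assms
proof (induction m rule: dec_induct)
  case (step m)
  then show ?case
    using dist_triangle[of "s n" "s (Suc m)" "s m"] by (simp add: sum.atLeastLessThan_Suc)
qed simp

lemma summable_steps_imp_Cauchy:
  fixes s :: "nat \<Rightarrow> 'a::metric_space"
  assumes "summable (\<lambda>i. dist (s i) (s (Suc i)))"
  shows "Cauchy s"
proof (rule CauchyI')
  fix e :: real
  assume "0 < e"
  then obtain N where N: "norm (\<Sum>i=m..<n. dist (s i) (s (Suc i))) < e" if "m \<ge> N" for m n
    using assms unfolding summable_Cauchy by blast
  then show "\<exists>M. \<forall>m\<ge>M. \<forall>n>m. dist (s m) (s n) < e"
    using dist_le_sum_steps[of _ _ s]
    by (intro exI[of _ N]) (smt (verit) less_imp_le_nat real_norm_def)
qed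

lemma dist_limit_le_suminf_steps:
  fixes s :: "nat \<Rightarrow> 'a::metric_space"
  assumes "summable (\<lambda>i. dist (s i) (s (Suc i)))" "s \<longlonglongrightarrow> l"
  shows "dist (s 0) l \<le> (\<Sum>i. dist (s i) (s (Suc i)))"
proof (rule LIMSEQ_le_const2)
  show "(\<lambda>n. dist (s 0) (s n)) \<longlonglongrightarrow> dist (s 0) l"
    by (intro tendsto_intros assms)
  have "dist (s 0) (s n) \<le> (\<Sum>i. dist (s i) (s (Suc i)))" for n
    using dist_le_sum_steps[of 0 n s] sum_le_suminf[OF assms(1), of "{0..<n}"] by simp
  then show "\<exists>N. \<forall>n\<ge>N. dist (s 0) (s n) \<le> (\<Sum>i. dist (s i) (s (Suc i)))"
    by blast
qed

section \<open>Bounded sets in linear topological spaces\<close>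

lemma tendsto_scaleR_lts:
  fixes g :: "'c \<Rightarrow> 'b::linear_topological_space"
  assumes "(c \<longlongrightarrow> a) F" "(g \<longlongrightarrow> b) F"
  shows "((\<lambda>x. c x *\<^sub>R g x) \<longlongrightarrow> a *\<^sub>R b) F"
  using filterlim_compose[OF tendsto_scaleR_Pair filterlim_Pair[OF assms]] by simp

lemma ex_neighbourhood_diff_subset:
  fixes U :: "'b::topological_ab_group_add set"
  assumes "open U" "0 \<in> U"
  shows "\<exists>W. open W \<and> 0 \<in> W \<and> (\<forall>x\<in>W. \<forall>y\<in>W. x - y \<in> U)"
proof -
  have "((\<lambda>p::'b \<times> 'b. fst p - snd p) \<longlongrightarrow> 0 - 0) (nhds 0 \<times>\<^sub>F nhds 0)"
    by (intro tendsto_diff filterlim_fst filterlim_snd)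
  then have "\<forall>\<^sub>F p in nhds 0 \<times>\<^sub>F nhds (0::'b). fst p - snd p \<in> U"
    using assms by (auto dest: topological_tendstoD)
  then obtain P Q where PQ: "eventually P (nhds 0)" "eventually Q (nhds (0::'b))"
    "\<And>x y. P x \<Longrightarrow> Q y \<Longrightarrow> x - y \<in> U"
    unfolding eventually_prod_filter by auto
  have "eventually (\<lambda>x. P x \<and> Q x) (nhds 0)"
    using PQ by (simp add: eventually_conj)
  then show ?thesis
    using PQ(3) unfolding eventually_nhds by blast
qed

text \<open>
  Boundedness is used through scaling a set into a neighbourhood by small factors; unlike the
  definition by large factors, this form includes the factor \<open>0\<close> and needs no division.
\<close>

lemma tvs_boundedD:
  assumes "tvs_bounded M" "open U" "0 \<in> U"
  shows "\<exists>e>0. \<forall>t. \<bar>t\<bar> \<le> e \<longrightarrow> (\<forall>x\<in>M. t *\<^sub>R x \<in> U)"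
proof -
  obtain r where r: "r > 0" "\<And>t. \<bar>t\<bar> \<ge> r \<Longrightarrow> M \<subseteq> (\<lambda>u. t *\<^sub>R u) ` U"
    using assms unfolding tvs_bounded_def by blast
  have "t *\<^sub>R x \<in> U" if t: "\<bar>t\<bar> \<le> inverse r" and x: "x \<in> M" for t x
  proof (cases "t = 0")
    case False
    then have "r \<le> \<bar>inverse t\<bar>"
      using t r(1) by (simp add: field_simps)
    then obtain u where "u \<in> U" "x = inverse t *\<^sub>R u"
      using r(2) x by blast
    then show ?thesis
      using False by simp
  qed (use assms in simp)
  then show ?thesis
    using r(1) by (intro exI[of _ "inverse r"]) auto
qed

lemma tvs_boundedI:
  fixes M :: "'b::locally_convex_space set"
  assumes "\<And>U. open U \<Longrightarrow> 0 \<in> U \<Longrightarrow> \<exists>e>0. \<forall>t. \<bar>t\<bar> \<le> e \<longrightarrow> (\<forall>x\<in>M. t *\<^sub>R x \<in> U)"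
  shows "tvs_bounded M"
  unfolding tvs_bounded_def
proof (intro allI impI)
  fix U :: "'b set"
  assume "open U \<and> 0 \<in> U"
  then obtain e where e: "e > 0" "\<And>t x. \<bar>t\<bar> \<le> e \<Longrightarrow> x \<in> M \<Longrightarrow> t *\<^sub>R x \<in> U"
    using assms by meson
  have "x \<in> (\<lambda>u. t *\<^sub>R u) ` U" if "\<bar>t\<bar> \<ge> inverse e" "x \<in> M" for t x
  proof -
    have "t \<noteq> 0"
      using that(1) e(1) by auto
    moreover have "\<bar>inverse t\<bar> \<le> e"
      using that(1) e(1) \<open>t \<noteq> 0\<close> by (simp add: field_simps)
    ultimately show ?thesis
      using e(2)[of "inverse t" x] that(2) by (intro image_eqI[of _ _ "inverse t *\<^sub>R x"]) auto
  qed
  then show "\<exists>r>0. \<forall>t. r \<le> \<bar>t\<bar> \<longrightarrow> M \<subseteq> (\<lambda>u. t *\<^sub>R u) ` U"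
    using e(1) by (intro exI[of _ "inverse e"]) auto
qed

lemma tvs_bounded_singleton: "tvs_bounded {y :: 'b::locally_convex_space}"
proof (rule tvs_boundedI)
  fix U :: "'b set"
  assume U: "open U" "0 \<in> U"
  have "((\<lambda>t. t *\<^sub>R y) \<longlongrightarrow> 0 *\<^sub>R y) (nhds 0)"
    by (intro tendsto_scaleR_lts tendsto_const) (rule filterlim_ident)
  then have "\<forall>\<^sub>F t in nhds 0. t *\<^sub>R y \<in> U"
    using U by (auto dest: topological_tendstoD)
  then obtain d where "d > 0" "\<And>t. dist t 0 < d \<Longrightarrow> t *\<^sub>R y \<in> U"
    unfolding eventually_nhds_metric by blast
  then show "\<exists>e>0. \<forall>t. \<bar>t\<bar> \<le> e \<longrightarrow> (\<forall>x\<in>{y}. t *\<^sub>R x \<in> U)"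
    by (intro exI[of _ "d / 2"]) auto
qed

lemma tvs_bounded_differences:
  assumes "tvs_bounded A" "tvs_bounded B"
  shows "tvs_bounded {a - b |a b. a \<in> A \<and> b \<in> B}"
proof (rule tvs_boundedI)
  fix U :: "'a set"
  assume "open U" "0 \<in> U"
  then obtain W where W: "open W" "0 \<in> W" "\<And>x y. x \<in> W \<Longrightarrow> y \<in> W \<Longrightarrow> x - y \<in> U"
    using ex_neighbourhood_diff_subset by metis
  obtain d where d: "d > 0" "\<And>t x. \<bar>t\<bar> \<le> d \<Longrightarrow> x \<in> A \<Longrightarrow> t *\<^sub>R x \<in> W"
    using tvs_boundedD[OF assms(1) W(1,2)] by blast
  obtain e where e: "e > 0" "\<And>t x. \<bar>t\<bar> \<le> e \<Longrightarrow> x \<in> B \<Longrightarrow> t *\<^sub>R x \<in> W"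
    using tvs_boundedD[OF assms(2) W(1,2)] by blast
  show "\<exists>e>0. \<forall>t. \<bar>t\<bar> \<le> e \<longrightarrow> (\<forall>x\<in>{a - b |a b. a \<in> A \<and> b \<in> B}. t *\<^sub>R x \<in> U)"
    using d e W(3) by (intro exI[of _ "min d e"]) (auto simp: scaleR_diff_right)
qed

section \<open>Weighted series in a convex, bounded, semi-complete set\<close>

lemma convex_weighted_sum:
  fixes D :: "'b::real_vector set"
  assumes "convex D" "D \<noteq> {}" "\<And>i. i \<in> I \<Longrightarrow> 0 \<le> a i" "\<And>i. i \<in> I \<Longrightarrow> v i \<in> D"
  shows "\<exists>w\<in>D. (\<Sum>i\<in>I. a i *\<^sub>R v i) = sum a I *\<^sub>R w"
proof (cases "finite I \<and> sum a I \<noteq> 0")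
  case True
  have "(\<Sum>i\<in>I. (a i / sum a I) *\<^sub>R v i) \<in> D"
    using True assms
    by (intro convex_sum) (auto simp: sum_nonneg simp flip: sum_divide_distrib)
  moreover have "sum a I *\<^sub>R (\<Sum>i\<in>I. (a i / sum a I) *\<^sub>R v i) = (\<Sum>i\<in>I. a i *\<^sub>R v i)"
    using True by (simp add: scaleR_sum_right)
  ultimately show ?thesis
    by metis
next
  case False
  then have "(\<Sum>i\<in>I. a i *\<^sub>R v i) = 0"
    using assms(3) by (cases "finite I") (auto simp: sum_nonneg_eq_0_iff)
  then show ?thesis
    using False assms(2) by fastforce
qed

text \<open>
  With \<open>S\<^sub>m\<close> the partial sums of \<open>a\<close>, the partial sums of the series are \<open>S\<^sub>m w\<^sub>m\<close> with averages \<open>w\<^sub>m \<in> D\<close>.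
  For \<open>l \<le> m\<close>, \<open>w\<^sub>m\<close> is a convex combination of \<open>w\<^sub>l\<close> and the average \<open>u\<close> of the terms in between, whose
  weight \<open>(S\<^sub>m - S\<^sub>l) / S\<^sub>m\<close> is small.  So \<open>w\<^sub>m - w\<^sub>l\<close> is a small multiple of an element of the bounded set
  of differences of \<open>D\<close>, and semi-completeness applies to the averages.  It could not be applied to
  the partial sums themselves, which need not lie in \<open>D\<close>.
\<close>

lemma weighted_series_converges:
  fixes D :: "'b::locally_convex_space set"
  assumes D: "convex D" "tvs_bounded D" "semi_complete D"
    and v: "\<And>i. v i \<in> D"
    and a: "\<And>i. 0 \<le> a i" "summable a"
  shows "\<exists>w\<in>D. (\<lambda>m. \<Sum>i<m. a i *\<^sub>R v i) \<longlonglongrightarrow> suminf a *\<^sub>R w"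
proof (cases "suminf a = 0")
  case True
  then have "a i = 0" for i
    using a suminf_eq_zero_iff by metis
  then show ?thesis
    using True v by (intro bexI[of _ "v 0"]) auto
next
  case False
  define S where "S m = (\<Sum>i<m. a i)" for m
  have lim: "S \<longlonglongrightarrow> suminf a"
    using a(2) unfolding S_def by (rule summable_LIMSEQ)
  \<comment> \<open>The averages are determined only from an index \<open>N\<close> with \<open>S N > 0\<close> on; all estimates start there.\<close>
  have "suminf a > 0"
    using False suminf_nonneg[OF a(2,1)] by simp
  then have "\<forall>\<^sub>F n in sequentially. 0 < S n"
    by (rule order_tendstoD(1)[OF lim])
  then obtain N where N: "0 < S N"
    by (auto simp: eventually_sequentially)
  have S_mono: "S l \<le> S m" if "l \<le> m" for l m
    unfolding S_def using that a(1) by (intro sum_mono2) auto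
  obtain w where w: "\<And>m. w m \<in> D" "\<And>m. (\<Sum>i<m. a i *\<^sub>R v i) = S m *\<^sub>R w m"
    using convex_weighted_sum[of D "{..<_}" a v] D(1) a(1) v unfolding S_def by (metis empty_iff)
  have diff: "\<exists>u\<in>D. w m - w l = ((S m - S l) / S m) *\<^sub>R (u - w l)" if "N \<le> l" "l \<le> m" for l m
  proof -
    have split: "(\<Sum>i<m. b i) = (\<Sum>i<l. b i) + (\<Sum>i=l..<m. b i)" for b :: "nat \<Rightarrow> 'c::comm_monoid_add"
      using sum.atLeastLessThan_concat[of 0 l m b] that by (simp add: atLeast0LessThan)
    obtain u where u: "u \<in> D" "(\<Sum>i=l..<m. a i *\<^sub>R v i) = (\<Sum>i=l..<m. a i) *\<^sub>R u"
      using convex_weighted_sum[of D "{l..<m}" a v] D(1) a(1) v by (metis empty_iff)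
    have "S m *\<^sub>R w m = S l *\<^sub>R w l + (S m - S l) *\<^sub>R u"
      using split[of "\<lambda>i. a i *\<^sub>R v i"] split[of a] w(2) u(2) by (simp add: S_def)
    then have "S m *\<^sub>R (w m - w l) = (S m - S l) *\<^sub>R (u - w l)"
      by (simp add: algebra_simps)
    moreover have "S m > 0"
      using N S_mono that by (meson le_trans less_le_trans)
    ultimately have "w m - w l = inverse (S m) *\<^sub>R ((S m - S l) *\<^sub>R (u - w l))"
      by (metis less_irrefl scaleR_one scaleR_scaleR left_inverse)
    then show ?thesis
      using u(1) by (auto simp: divide_inverse mult.commute)
  qed
  have "tvs_Cauchy w"
    unfolding tvs_Cauchy_def
  proof (intro allI impI)
    fix U :: "'b set"
    assume "open U \<and> 0 \<in> U"
    then obtain e where e: "e > 0"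
      "\<And>t x y. \<bar>t\<bar> \<le> e \<Longrightarrow> x \<in> D \<Longrightarrow> y \<in> D \<Longrightarrow> t *\<^sub>R (x - y) \<in> U"
      using tvs_boundedD[OF tvs_bounded_differences[OF D(2) D(2)], of U] by blast
    have "e * S N > 0"
      using e N by simp
    then obtain N' where N': "\<And>m n. m \<ge> N' \<Longrightarrow> n \<ge> N' \<Longrightarrow> dist (S m) (S n) < e * S N"
      using LIMSEQ_imp_Cauchy[OF lim] unfolding Cauchy_def by meson
    have small: "w m - w l \<in> U \<and> w l - w m \<in> U" if lm: "max N N' \<le> l" "l \<le> m" for l m
    proof -
      obtain u where u: "u \<in> D" "w m - w l = ((S m - S l) / S m) *\<^sub>R (u - w l)"
        using diff[of l m] lm by auto
      have "\<bar>S m - S l\<bar> \<le> e * S N"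
        using N'[of m l] lm by (simp add: dist_real_def)
      also have "\<dots> \<le> e * S m"
        using S_mono[of N m] lm e by simp
      finally have c: "\<bar>(S m - S l) / S m\<bar> \<le> e"
        using N S_mono[of N m] lm by (simp add: field_simps)
      have "w l - w m = ((S m - S l) / S m) *\<^sub>R (w l - u)"
        using arg_cong[OF u(2), of uminus] by (simp flip: scaleR_minus_right)
      then show ?thesis
        using e(2)[OF c] u w(1) by metis
    qed
    have "w m - w n \<in> U" if "max N N' \<le> m" "max N N' \<le> n" for m n
      using small[of m n] small[of n m] that by (cases "m \<le> n") auto
    then show "\<exists>N. \<forall>m\<ge>N. \<forall>n\<ge>N. w m - w n \<in> U"
      by blast
  qed
  then obtain x where x: "x \<in> D" "w \<longlonglongrightarrow> x"
    using D(3) w(1) unfolding semi_complete_def by blast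
  have "(\<lambda>m. S m *\<^sub>R w m) \<longlonglongrightarrow> suminf a *\<^sub>R x"
    using lim x(2) by (rule tendsto_scaleR_lts)
  then show ?thesis
    using x(1) w(2) by auto
qed

section \<open>The preorder of Ekeland's principle\<close>

definition descent :: "'b::real_vector set \<Rightarrow> 'b set \<Rightarrow> ('a::metric_space \<Rightarrow> 'b) \<Rightarrow> 'a \<Rightarrow> 'a \<Rightarrow> bool"
  where "descent K D f x z \<longleftrightarrow> (\<exists>v\<in>D. f x - f z - dist x z *\<^sub>R v \<in> K)"

lemma image_inter_nonempty_iff_descent:
  "(\<lambda>k. f x - k) ` K \<inter> (\<lambda>v. f z + dist x z *\<^sub>R v) ` D \<noteq> {} \<longleftrightarrow> descent K D f x z"
proof -
  have "f x - k = f z + dist x z *\<^sub>R v \<longleftrightarrow> k = f x - f z - dist x z *\<^sub>R v" for k v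
    by (auto simp: algebra_simps)
  then show ?thesis
    by (auto simp: descent_def)
qed

lemma cone_add:
  fixes K :: "'b::real_vector set"
  assumes "convex K" "cone K" "x \<in> K" "y \<in> K"
  shows "x + y \<in> K"
proof -
  have "(1/2) *\<^sub>R x + (1/2) *\<^sub>R y \<in> K"
    using assms convexD[of K x y "1/2" "1/2"] by simp
  then have "2 *\<^sub>R ((1/2) *\<^sub>R x + (1/2) *\<^sub>R y) \<in> K"
    using assms(2) mem_cone[of K _ 2] by simp
  then show ?thesis
    by (simp add: scaleR_add_right)
qed

text \<open>
  A step may be witnessed with a length exceeding the distance: the surplus \<open>(t - d(x,z)) v\<close> lies
  in \<open>K\<close> because \<open>D \<subseteq> K\<close>.  This is where path lengths replace distances.
\<close>

lemma descentI:
  fixes K :: "'b::real_vector set"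
  assumes "convex K" "cone K" "D \<subseteq> K"
    and "v \<in> D" "dist x z \<le> t" "f x - f z - t *\<^sub>R v \<in> K"
  shows "descent K D f x z"
proof -
  have "(t - dist x z) *\<^sub>R v \<in> K"
    using assms mem_cone[of K v "t - dist x z"] by auto
  then have "f x - f z - t *\<^sub>R v + (t - dist x z) *\<^sub>R v \<in> K"
    using assms cone_add by blast
  then show ?thesis
    using assms(4) by (auto simp: descent_def algebra_simps)
qed

lemma descent_refl:
  assumes "cone K" "D \<subseteq> K" "D \<noteq> {}"
  shows "descent K D f x x"
  using assms cone_contains_0[of K] by (auto simp: descent_def)

lemma descent_trans:
  fixes K :: "'b::real_vector set"
  assumes K: "convex K" "cone K" "D \<subseteq> K" and D: "convex D"
    and xy: "descent K D f x y" and yz: "descent K D f y z"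
  shows "descent K D f x z"
proof -
  obtain v where v: "v \<in> D" "f x - f y - dist x y *\<^sub>R v \<in> K"
    using xy by (auto simp: descent_def)
  obtain w where w: "w \<in> D" "f y - f z - dist y z *\<^sub>R w \<in> K"
    using yz by (auto simp: descent_def)
  obtain u where u: "u \<in> D"
    "dist x y *\<^sub>R v + dist y z *\<^sub>R w = (dist x y + dist y z) *\<^sub>R u"
  proof -
    let ?a = "\<lambda>b. if b then dist x y else dist y z" and ?v = "\<lambda>b. if b then v else w"
    have "\<exists>u\<in>D. (\<Sum>b\<in>{True, False}. ?a b *\<^sub>R ?v b) = (\<Sum>b\<in>{True, False}. ?a b) *\<^sub>R u"
      using v(1) w(1) by (intro convex_weighted_sum[OF D]) auto
    then obtain u where "u \<in> D"
      "(\<Sum>b\<in>{True, False}. ?a b *\<^sub>R ?v b) = (\<Sum>b\<in>{True, False}. ?a b) *\<^sub>R u"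
      by blast
    then show ?thesis
      by (intro that[of u]) simp_all
  qed
  have "f x - f y - dist x y *\<^sub>R v + (f y - f z - dist y z *\<^sub>R w)
      = f x - f z - (dist x y + dist y z) *\<^sub>R u"
    unfolding u(2)[symmetric] by (simp add: algebra_simps)
  then have "f x - f z - (dist x y + dist y z) *\<^sub>R u \<in> K"
    using cone_add[OF K(1,2) v(2) w(2)] by metis
  then show ?thesis
    using descentI[OF K u(1) dist_triangle] by blast
qed

text \<open>
  If \<open>f z = k + m\<close> with \<open>k \<in> K\<close> and \<open>m \<in> M\<close>, then \<open>(f x - m) / t\<close> is the sum of \<open>v\<close> and an element of \<open>K\<close>, while
  the bounded set \<open>f x - M\<close> is scaled into the complement of the closure of \<open>D + K\<close> once \<open>t\<close> is large,
  uniformly in \<open>z\<close>.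
\<close>

lemma descent_length_bounded:
  fixes f :: "'a \<Rightarrow> 'b::locally_convex_space"
  assumes K: "convex K" "cone K"
    and apart: "0 \<notin> closure (D + K)"
    and f: "cone_bounded K f"
  shows "\<exists>T. \<forall>z t. \<forall>v\<in>D. f x - f z - t *\<^sub>R v \<in> K \<longrightarrow> t \<le> T"
proof -
  obtain M where M: "tvs_bounded M" "range f \<subseteq> K + M"
    using f unfolding cone_bounded_def by blast
  obtain e where e: "e > 0"
    "\<And>t m. \<bar>t\<bar> \<le> e \<Longrightarrow> m \<in> M \<Longrightarrow> t *\<^sub>R (f x - m) \<notin> closure (D + K)"
    using tvs_boundedD[OF tvs_bounded_differences[OF tvs_bounded_singleton M(1)],
        of "- closure (D + K)" "f x"] apart
    by (auto simp: open_Compl)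
  have "t \<le> inverse e" if v: "v \<in> D" "f x - f z - t *\<^sub>R v \<in> K" for z t v
  proof (rule ccontr)
    assume "\<not> t \<le> inverse e"
    then have "inverse e < t" "t > 0"
      using e(1) by (auto intro: less_trans[of 0 "inverse e"])
    then have t: "t > 0" "\<bar>inverse t\<bar> \<le> e"
      using e(1) by (auto simp: field_simps)
    obtain k m where km: "k \<in> K" "m \<in> M" "f z = k + m"
      using M(2) by (fastforce elim: set_plus_elim)
    define k' where "k' = inverse t *\<^sub>R (f x - f z - t *\<^sub>R v + k)"
    have "k' \<in> K"
      unfolding k'_def using cone_add[OF K v(2) km(1)] t(1) mem_cone[OF K(2)] by simp
    moreover have "inverse t *\<^sub>R (f x - m) = v + k'"
      using t(1) by (simp add: k'_def km(3) algebra_simps)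
    ultimately have "inverse t *\<^sub>R (f x - m) \<in> closure (D + K)"
      using v(1) closure_subset set_plus_intro by (metis subsetD)
    then show False
      using e(2) t(2) km(2) by blast
  qed
  then show ?thesis
    by blast
qed

lemma descent_chain_sum:
  fixes K :: "'b::real_vector set"
  assumes K: "convex K" "cone K" "0 \<in> K"
    and step: "\<And>i. f (s i) - f (s (Suc i)) - dist (s i) (s (Suc i)) *\<^sub>R v i \<in> K"
  shows "f (s 0) - f (s m) - (\<Sum>i<m. dist (s i) (s (Suc i)) *\<^sub>R v i) \<in> K"
proof (induction m)
  case (Suc m)
  show ?case
    using cone_add[OF K(1,2) Suc step[of m]] by (simp add: algebra_simps)
qed (use K in simp)

text \<open>
  The chain itself only gives relations \<open>f (s n) - f (s m) - \<dots> \<in> K\<close> between its terms.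
  Semicontinuity adds \<open>f (s m) - f l \<in> K\<close>, which removes \<open>f (s m)\<close> before \<open>m\<close> tends to infinity; the only
  quantity still depending on \<open>m\<close> is a partial sum of a weighted series in \<open>D\<close>.
\<close>

lemma descent_chain_limit:
  fixes f :: "'a::complete_space \<Rightarrow> 'b::locally_convex_space"
  assumes K: "closed K" "convex K" "cone K"
    and D: "D \<subseteq> K" "D \<noteq> {}" "semi_complete D" "convex D" "tvs_bounded D"
    and apart: "0 \<notin> closure (D + K)"
    and f: "monotonically_semicontinuous K f" "cone_bounded K f"
    and chain: "\<And>n. descent K D f (s n) (s (Suc n))"
  shows "\<exists>l. s \<longlonglongrightarrow> l \<and> (\<forall>n. descent K D f (s n) l)"
proof -
  obtain v where v: "\<And>i. v i \<in> D"
    "\<And>i. f (s i) - f (s (Suc i)) - dist (s i) (s (Suc i)) *\<^sub>R v i \<in> K"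
    using chain unfolding descent_def by metis
  have K0: "0 \<in> K"
    using K(3) D(1,2) cone_contains_0 by blast
  have summable: "summable (\<lambda>i. dist (s i) (s (Suc i)))"
  proof -
    obtain T where T: "\<And>v z t. v \<in> D \<Longrightarrow> f (s 0) - f z - t *\<^sub>R v \<in> K \<Longrightarrow> t \<le> T"
      using descent_length_bounded[OF K(2,3) apart f(2)] by blast
    have "(\<Sum>i<m. dist (s i) (s (Suc i))) \<le> T" for m
    proof -
      obtain w where "w \<in> D" "(\<Sum>i<m. dist (s i) (s (Suc i)) *\<^sub>R v i)
          = (\<Sum>i<m. dist (s i) (s (Suc i))) *\<^sub>R w"
        using convex_weighted_sum[OF D(4,2), of "{..<m}" "\<lambda>i. dist (s i) (s (Suc i))" v] v(1)
        by auto
      then show ?thesis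
        using T[of w "s m" "\<Sum>i<m. dist (s i) (s (Suc i))"]
          descent_chain_sum[where f = f and s = s and v = v and m = m, OF K(2,3) K0 v(2)] by simp
    qed
    then show ?thesis
      by (intro summableI_nonneg_bounded) auto
  qed
  then obtain l where l: "s \<longlonglongrightarrow> l"
    using summable_steps_imp_Cauchy Cauchy_convergent_iff convergent_def by metis
  have decreasing: "f (s i) - f (s (Suc i)) \<in> K" for i
  proof -
    have "dist (s i) (s (Suc i)) *\<^sub>R v i \<in> K"
      using v(1)[of i] D(1) by (intro mem_cone[OF K(3)]) auto
    from cone_add[OF K(2,3) v(2)[of i] this] show ?thesis
      by simp
  qed
  have below: "f (s i) - f l \<in> K" for i
    using f(1) l decreasing
    unfolding monotonically_semicontinuous_def monotonically_semicontinuous_at_def cone_le_def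
    by blast
  have "descent K D f (s n) l" for n
  proof -
    \<comment> \<open>The lengths of the steps after \<open>s n\<close>; their sum is at least the distance from \<open>s n\<close> to \<open>l\<close>.\<close>
    define c where "c i = dist (s (i + n)) (s (Suc (i + n)))" for i
    have c: "\<And>i. 0 \<le> c i" "summable c"
      using summable_ignore_initial_segment[OF summable, of n] unfolding c_def by auto
    obtain w where w: "w \<in> D" "(\<lambda>m. \<Sum>i<m. c i *\<^sub>R v (i + n)) \<longlonglongrightarrow> suminf c *\<^sub>R w"
      using weighted_series_converges[OF D(4,5,3), of "\<lambda>i. v (i + n)" c] v(1) c by blast
    have "f (s n) - f l - (\<Sum>i<m. c i *\<^sub>R v (i + n)) \<in> K" for m
      using cone_add[OF K(2,3) descent_chain_sum[where f = f and s = "\<lambda>i. s (i + n)" and m = m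
          and v = "\<lambda>i. v (i + n)", OF K(2,3) K0] below[of "m + n"]] v(2)
      by (simp add: c_def algebra_simps)
    moreover have "(\<lambda>m. f (s n) - f l - (\<Sum>i<m. c i *\<^sub>R v (i + n)))
        \<longlonglongrightarrow> f (s n) - f l - suminf c *\<^sub>R w"
      by (intro tendsto_diff tendsto_const w)
    ultimately have "f (s n) - f l - suminf c *\<^sub>R w \<in> K"
      by (intro Lim_in_closed_set[OF K(1)]) auto
    moreover have "dist (s n) l \<le> suminf c"
      using dist_limit_le_suminf_steps[of "\<lambda>i. s (i + n)" l] c(2) LIMSEQ_ignore_initial_segment[OF l]
      by (simp add: c_def[abs_def])
    ultimately show ?thesis
      using descentI[OF K(2,3) D(1) w(1)] by blast
  qed
  then show ?thesis
    using l by blast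
qed

theorem theorem4p1:
  fixes f :: "'a::complete_space \<Rightarrow> 'b::locally_convex_space"
    and K D :: "'b set"
  assumes "closed K" and "convex K" and "cone K"
    and "D \<subseteq> K" and "D \<noteq> {}" and "closed D" and "semi_complete D"
    and "convex D" and "tvs_bounded D"
    and "0 \<notin> closure (D + K)"
    and "monotonically_semicontinuous K f"
    and "cone_bounded K f"
  shows "\<forall>x. \<exists>xb.
      (\<lambda>k. f x - k) ` K \<inter> (\<lambda>v. f xb + dist x xb *\<^sub>R v) ` D \<noteq> {} \<and>
      (\<forall>z. z \<noteq> xb \<longrightarrow>
        (\<lambda>k. f xb - k) ` K \<inter> (\<lambda>v. f z + dist z xb *\<^sub>R v) ` D = {})"
proof
  fix x
  have "\<exists>xb. descent K D f x xb \<and> (\<forall>z. descent K D f xb z \<longrightarrow> z = xb)"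
  proof (rule ex_minimal_of_chain_limits)
    show "descent K D f x x" for x
      using assms by (intro descent_refl)
    show "descent K D f x z" if "descent K D f x y" "descent K D f y z" for x y z
      using assms that descent_trans by blast
    show "\<exists>l. s \<longlonglongrightarrow> l \<and> (\<forall>n. descent K D f (s n) l)"
      if "\<And>n. descent K D f (s n) (s (Suc n))" for s
      using assms that by (intro descent_chain_limit)
  qed
  then obtain xb where "descent K D f x xb" "\<And>z. z \<noteq> xb \<Longrightarrow> \<not> descent K D f xb z"
    by blast
  then show "\<exists>xb.
      (\<lambda>k. f x - k) ` K \<inter> (\<lambda>v. f xb + dist x xb *\<^sub>R v) ` D \<noteq> {} \<and>
      (\<forall>z. z \<noteq> xb \<longrightarrow>
        (\<lambda>k. f xb - k) ` K \<inter> (\<lambda>v. f z + dist z xb *\<^sub>R v) ` D = {})"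
    using image_inter_nonempty_iff_descent[of f _ K _ D] by (metis dist_commute)
qed

end
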